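(* Let $p\in\mathbb{R}$. The inequality $P_p(a,b)<N(a,b)$ holds for all $a,b>0$ with $a\neq b$ if and only if $p\le 2$.
   Context: For $a,b>0$ with $a\ne b$ the first Seiffert mean is $P(a,b)=\dfrac{a-b}{2\arcsin\frac{a-b}{a+b}}$ and the Neuman-Sándor mean is $N(a,b)=\dfrac{a-b}{2\,\mathrm{arcsinh}\frac{a-b}{a+b}}$, with $P(a,a)=N(a,a)=a$. For $p\in\mathbb{R}$, $P_p(a,b)=\left(P(a^p,b^p)\right)^{1/p}$ if $p\neq0$ and $P_0(a,b)=\sqrt{ab}$. *)

theory Defs
  imports Complex_Main
begin

definition seiffert_mean :: "real \<Rightarrow> real \<Rightarrow> real" where
  "seiffert_mean a b =
     (if a = b then a else (a - b) / (2 * arcsin ((a - b) / (a + b))))"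

definition neuman_sandor_mean :: "real \<Rightarrow> real \<Rightarrow> real" where
  "neuman_sandor_mean a b =
     (if a = b then a else (a - b) / (2 * arsinh ((a - b) / (a + b))))"

(* Meaningful for a, b > 0 only; there every base of powr is positive. *)
definition seiffert_mean_pow :: "real \<Rightarrow> real \<Rightarrow> real \<Rightarrow> real" where
  "seiffert_mean_pow p a b =
     (if p = 0 then sqrt (a * b) else seiffert_mean (a powr p) (b powr p) powr (1 / p))"

end

theory Submission
  imports Defs "HOL-Real_Asymp.Real_Asymp"
begin

text \<open>
  Both means are homogeneous and symmetric, so it is enough to compare them on pairs
  \<open>e\<^sup>x, e\<^sup>-\<^sup>x\<close> with \<open>x > 0\<close>. There \<open>(a - b) / (a + b) = tanh x\<close>, and since
  \<open>arcsin (tanh x) = arctan (sinh x)\<close>, the logarithms of the two means are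
  \<open>S x = ln (sinh x / arctan (sinh x))\<close> and \<open>T x = ln (sinh x / arsinh (tanh x))\<close>. Raising both
  entries to the power \<open>p\<close> replaces \<open>x\<close> by \<open>p x\<close>, so the inequality to be decided is
  \<open>S (p x) / p < T x\<close> for all \<open>x > 0\<close> (lemma \<open>seiffert_mean_pow_less_iff\<close>).

  For \<open>p = 2\<close>, put \<open>u = tanh x\<close>. Then \<open>sinh (2 x) = 2 u / (1 - u\<^sup>2)\<close>, whose arctangent is
  \<open>2 arctan u\<close>, and the inequality collapses to \<open>(arsinh u)\<^sup>2 < u arctan u\<close>. With \<open>u = sinh y\<close>
  this says that \<open>arctan (sinh y) - y\<^sup>2 / sinh y\<close> is positive for \<open>y > 0\<close>; it vanishes at \<open>0\<close>
  and its derivative is a square divided by \<open>cosh y\<close>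
  (lemma \<open>square_less_sinh_mult_arctan_sinh\<close>).

  Smaller \<open>p\<close> follow from \<open>S (p x) / p \<le> S (2 x) / 2\<close>. For \<open>p \<le> 0\<close> the left side is not
  positive, because \<open>S\<close> is even and positive away from \<open>0\<close>. For \<open>0 < p \<le> 2\<close> it is the chord
  inequality of a convex function vanishing at \<open>0\<close>
  (lemma \<open>log_seiffert_scale_le\<close>).

  The bound \<open>2\<close> is optimal because \<open>S x\<close> behaves like \<open>x\<^sup>2 / 3\<close> and \<open>T x\<close> like \<open>2 x\<^sup>2 / 3\<close> near
  \<open>0\<close>: after division by \<open>x\<^sup>2\<close> the two sides tend to \<open>p / 3\<close> and \<open>2 / 3\<close>, so for \<open>p > 2\<close> the
  inequality is reversed for all small \<open>x\<close> (lemma \<open>ex_log_neuman_sandor_less\<close>).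
\<close>

section \<open>Means in the hyperbolic parameter\<close>

definition log_seiffert :: "real \<Rightarrow> real" where
  "log_seiffert x = ln (sinh x / arctan (sinh x))"

definition log_neuman_sandor :: "real \<Rightarrow> real" where
  "log_neuman_sandor x = ln (sinh x / arsinh (tanh x))"

lemma one_minus_tanh_square: "1 - (tanh x)\<^sup>2 = 1 / (cosh (x::real))\<^sup>2"
proof -
  have "1 - (tanh x)\<^sup>2 = ((cosh x)\<^sup>2 - (sinh x)\<^sup>2) / (cosh x)\<^sup>2"
    by (simp add: tanh_def power_divide diff_divide_distrib)
  then show ?thesis
    by (simp only: hyperbolic_pythagoras)
qed

text \<open>
  Both sides are the Gudermannian of \<open>x\<close>; this identity is what makes the first Seiffert
  mean tractable in the hyperbolic parameter.
\<close>

lemma arcsin_tanh: "arcsin (tanh x) = arctan (sinh (x::real))"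
proof -
  have "sqrt (1 - (tanh x)\<^sup>2) = 1 / cosh x"
    by (simp add: one_minus_tanh_square real_sqrt_divide)
  then have "tanh x / sqrt (1 - (tanh x)\<^sup>2) = sinh x"
    by (simp add: tanh_def)
  then show ?thesis
    using arcsin_arctan[of "tanh x"] tanh_real_lt_1[of x] tanh_real_gt_neg1[of x] by simp
qed

lemma exp_pair_ratio:
  assumes "g > 0"
  shows "(g * exp x - g * exp (-x)) / (g * exp x + g * exp (-x)) = tanh (x::real)"
proof -
  have "g * exp x - g * exp (-x) = (2 * g) * sinh x" "g * exp x + g * exp (-x) = (2 * g) * cosh x"
    by (simp_all add: sinh_field_def cosh_field_def algebra_simps)
  with assms show ?thesis by (simp add: tanh_def)
qed

lemma arsinh_pos: "0 < x \<Longrightarrow> 0 < arsinh (x::real)"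
  using arsinh_real_strict_mono by (metis arsinh_0 strict_monoD)

lemma arctan_less_self:
  assumes "0 < (x::real)"
  shows "arctan x < x"
proof -
  have "0 - arctan 0 < x - arctan x"
  proof (rule DERIV_pos_imp_increasing_open[OF assms])
    fix y :: real
    assume "0 < y"
    have "((\<lambda>y. y - arctan y) has_real_derivative 1 - inverse (1 + y\<^sup>2)) (at y)"
      by (auto intro!: derivative_eq_intros)
    moreover have "1 - inverse (1 + y\<^sup>2) > 0"
      using \<open>0 < y\<close> by (simp add: inverse_less_1_iff)
    ultimately show "\<exists>d. ((\<lambda>y. y - arctan y) has_real_derivative d) (at y) \<and> d > 0"
      by blast
  qed (auto intro!: continuous_intros)
  then show ?thesis by simp
qed

lemma sinh_div_arctan_pos: "x \<noteq> 0 \<Longrightarrow> 0 < sinh x / arctan (sinh (x::real))"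
  by (cases "x > 0") (auto simp: zero_less_divide_iff)

lemma sinh_div_arsinh_pos: "x \<noteq> 0 \<Longrightarrow> 0 < sinh x / arsinh (tanh (x::real))"
  using arsinh_pos[of "tanh x"] arsinh_pos[of "- tanh x"]
  by (cases "x > 0") (auto simp: zero_less_divide_iff arsinh_minus_real)

lemma seiffert_mean_exp:
  assumes "g > 0" "x \<noteq> 0"
  shows "seiffert_mean (g * exp x) (g * exp (-x)) = g * exp (log_seiffert x)"
proof -
  have "g * exp x - g * exp (-x) = (2 * g) * sinh x"
    by (simp add: sinh_field_def algebra_simps)
  then show ?thesis
    using assms sinh_div_arctan_pos[of x] exp_pair_ratio[of g x] arcsin_tanh[of x]
    by (simp add: seiffert_mean_def log_seiffert_def)
qed

lemma neuman_sandor_mean_exp: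
  assumes "g > 0" "x \<noteq> 0"
  shows "neuman_sandor_mean (g * exp x) (g * exp (-x)) = g * exp (log_neuman_sandor x)"
proof -
  have "g * exp x - g * exp (-x) = (2 * g) * sinh x"
    by (simp add: sinh_field_def algebra_simps)
  then show ?thesis
    using assms sinh_div_arsinh_pos[of x] exp_pair_ratio[of g x]
    by (simp add: neuman_sandor_mean_def log_neuman_sandor_def)
qed

text \<open>
  The case \<open>p = 0\<close> is covered by the same formula: division by zero yields \<open>0\<close>, hence the value
  is \<open>g\<close>, the geometric mean of the two entries.
\<close>

lemma seiffert_mean_pow_exp:
  assumes "g > 0" "x \<noteq> 0"
  shows "seiffert_mean_pow p (g * exp x) (g * exp (-x)) = g * exp (log_seiffert (p * x) / p)"
proof (cases "p = 0")
  case True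
  have "g * exp x * (g * exp (-x)) = g\<^sup>2"
    by (simp add: exp_minus power2_eq_square)
  with True assms show ?thesis by (simp add: seiffert_mean_pow_def)
next
  case False
  have "(g * exp y) powr p = g powr p * exp (p * y)" for y
    using assms by (simp add: powr_def exp_add[symmetric] ln_mult algebra_simps)
  then have "seiffert_mean ((g * exp x) powr p) ((g * exp (-x)) powr p)
      = g powr p * exp (log_seiffert (p * x))"
    using seiffert_mean_exp[of "g powr p" "p * x"] False assms by simp
  with False assms show ?thesis
    by (simp add: seiffert_mean_pow_def powr_mult powr_powr) (simp add: powr_def)
qed

lemma log_seiffert_minus: "log_seiffert (-x) = log_seiffert x"
  by (simp add: log_seiffert_def arctan_minus)

lemma log_neuman_sandor_minus: "log_neuman_sandor (-x) = log_neuman_sandor x"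
  by (simp add: log_neuman_sandor_def arsinh_minus_real)

lemma seiffert_mean_pow_less_iff:
  "(\<forall>a b :: real. a > 0 \<and> b > 0 \<and> a \<noteq> b \<longrightarrow>
      seiffert_mean_pow p a b < neuman_sandor_mean a b)
    \<longleftrightarrow> (\<forall>x>0. log_seiffert (p * x) / p < log_neuman_sandor x)"
    (is "?M \<longleftrightarrow> ?L")
proof
  assume M: ?M
  show ?L
  proof (intro allI impI)
    fix x :: real
    assume "x > 0"
    then show "log_seiffert (p * x) / p < log_neuman_sandor x"
      using M[rule_format, of "exp x" "exp (-x)"]
        seiffert_mean_pow_exp[of 1 x p] neuman_sandor_mean_exp[of 1 x] by simp
  qed
next
  assume L: ?L
  show ?M
  proof (intro allI impI)
    fix a b :: real
    assume ab: "a > 0 \<and> b > 0 \<and> a \<noteq> b"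
    \<comment> \<open>\<open>g\<close> is the geometric mean \<open>sqrt (a b)\<close> and \<open>e\<^sup>2\<^sup>x = a / b\<close>.\<close>
    define g where "g = exp ((ln a + ln b) / 2)"
    define x where "x = (ln a - ln b) / 2"
    have g: "g > 0" and x: "x \<noteq> 0" using ab by (auto simp: g_def x_def)
    have a: "a = g * exp x" and b: "b = g * exp (-x)"
      using ab by (auto simp: g_def x_def exp_add[symmetric] diff_divide_distrib add_divide_distrib)
    have "log_seiffert (p * x) / p < log_neuman_sandor x"
    proof (cases "x > 0")
      case True
      with L show ?thesis by blast
    next
      case False
      with x have "-x > 0" by simp
      with L have "log_seiffert (p * -x) / p < log_neuman_sandor (-x)" by blast
      then show ?thesis by (simp add: log_seiffert_minus log_neuman_sandor_minus)
    qed
    then show "seiffert_mean_pow p a b < neuman_sandor_mean a b"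
      unfolding a b seiffert_mean_pow_exp[OF g x] neuman_sandor_mean_exp[OF g x]
      using g by simp
  qed
qed

section \<open>The exponent two\<close>

text \<open>
  The functions studied below are built from quotients of the form \<open>0 / 0\<close> at the left end point, where
  Isabelle's conventions give them the value \<open>0\<close>. This lemma reduces their continuity to a
  one-sided limit.
\<close>

lemma continuous_on_Icc_at_right:
  fixes f :: "real \<Rightarrow> real"
  assumes "(f \<longlongrightarrow> f a) (at_right a)" and "\<And>x. a < x \<Longrightarrow> isCont f x" and "a < b"
  shows "continuous_on {a..b} f"
proof (rule continuous_on_IccI)
  show "(f \<longlongrightarrow> f b) (at_left b)"
    using assms(2)[OF \<open>a < b\<close>] by (simp add: isCont_def filterlim_at_split)
qed (use assms in \<open>auto simp: isCont_def\<close>)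

lemma sinh_less_mult_cosh:
  assumes "0 < (x::real)"
  shows "sinh x < x * cosh x"
proof -
  have "0 * cosh 0 - sinh 0 < x * cosh x - sinh x"
  proof (rule DERIV_pos_imp_increasing_open[OF assms])
    fix y :: real
    assume "0 < y"
    have "((\<lambda>y. y * cosh y - sinh y) has_real_derivative y * sinh y) (at y)"
      by (auto intro!: derivative_eq_intros)
    with \<open>0 < y\<close> show "\<exists>d. ((\<lambda>y. y * cosh y - sinh y) has_real_derivative d) (at y) \<and> d > 0"
      by auto
  qed (auto intro!: continuous_intros)
  then show ?thesis by simp
qed

text \<open>
  The derivative of \<open>arctan (sinh y)\<close> is \<open>1 / cosh y\<close>, and subtracting the derivative of
  \<open>y\<^sup>2 / sinh y\<close> completes the square \<open>(1 - y cosh y / sinh y)\<^sup>2 / cosh y\<close>. The square does not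
  vanish since \<open>tanh y < y\<close>.
\<close>

lemma square_less_sinh_mult_arctan_sinh:
  assumes "0 < (x::real)"
  shows "x\<^sup>2 < sinh x * arctan (sinh x)"
proof -
  define f :: "real \<Rightarrow> real" where "f y = arctan (sinh y) - y\<^sup>2 / sinh y" for y
  have deriv: "(f has_real_derivative (1 - y * cosh y / sinh y)\<^sup>2 / cosh y) (at y)" if "0 < y" for y
  proof -
    have s: "sinh y > 0" and c: "cosh y > 0" using that by simp_all
    have "((\<lambda>y. arctan (sinh y)) has_real_derivative cosh y / (cosh y)\<^sup>2) (at y)"
      by (auto intro!: derivative_eq_intros simp: cosh_square_eq divide_inverse add.commute)
    moreover have "((\<lambda>y. y\<^sup>2 / sinh y) has_real_derivative
        (2 * y * sinh y - y\<^sup>2 * cosh y) / (sinh y)\<^sup>2) (at y)"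
      using s by (auto intro!: derivative_eq_intros simp: power2_eq_square)
    ultimately have "(f has_real_derivative
        cosh y / (cosh y)\<^sup>2 - (2 * y * sinh y - y\<^sup>2 * cosh y) / (sinh y)\<^sup>2) (at y)"
      unfolding f_def by (rule DERIV_diff)
    also have "cosh y / (cosh y)\<^sup>2 - (2 * y * sinh y - y\<^sup>2 * cosh y) / (sinh y)\<^sup>2
        = (1 - y * cosh y / sinh y)\<^sup>2 / cosh y"
      using s c by (simp add: field_simps power2_eq_square)
    finally show ?thesis .
  qed
  have "f 0 < f x"
  proof (rule DERIV_pos_imp_increasing_open[OF assms])
    fix y :: real
    assume y: "0 < y"
    then have "1 - y * cosh y / sinh y \<noteq> 0"
      using sinh_less_mult_cosh[of y] by (auto simp: field_simps)
    then have "(1 - y * cosh y / sinh y)\<^sup>2 / cosh y > 0"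
      by (intro divide_pos_pos) auto
    with deriv[OF y] show "\<exists>d. (f has_real_derivative d) (at y) \<and> d > 0"
      by blast
  next
    have "(f \<longlongrightarrow> 0) (at_right 0)"
      unfolding f_def by real_asymp
    then show "continuous_on {0..x} f"
      using deriv DERIV_isCont assms
      by (intro continuous_on_Icc_at_right) (auto simp: f_def[of 0])
  qed
  with assms show ?thesis by (simp add: f_def field_simps power2_eq_square)
qed


text \<open>
  The preceding inequality at the point \<open>arsinh (tanh x)\<close>. The double-angle formula
  for the arctangent expresses both sides through \<open>tanh x\<close>, and the factor \<open>1 / 2\<close> is matched
  by squaring the Neuman-Sandor side.
\<close>

lemma log_seiffert_two_less:
  assumes "0 < x"
  shows "log_seiffert (2 * x) / 2 < log_neuman_sandor x"
proof -
  define u where "u = tanh x"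
  have u: "0 < u" "u < 1" using assms by (simp_all add: u_def tanh_real_lt_1)
  have s: "sinh x > 0" and c: "cosh x > 0" and A: "arsinh u > 0"
    using assms arsinh_pos u by simp_all
  have key: "(arsinh u)\<^sup>2 < u * arctan u"
    using square_less_sinh_mult_arctan_sinh[OF A] by simp
  have "1 - u\<^sup>2 = 1 / (cosh x)\<^sup>2"
    by (simp add: u_def one_minus_tanh_square)
  then have "2 * u / (1 - u\<^sup>2) = sinh (2 * x)"
    using c by (simp add: u_def tanh_def sinh_double power2_eq_square)
  then have "arctan (sinh (2 * x)) = 2 * arctan u"
    using arctan_double[of u] u by simp
  then have "sinh (2 * x) / arctan (sinh (2 * x)) = sinh x * cosh x / arctan u"
    by (simp add: sinh_double)
  also have "\<dots> < (sinh x / arsinh u)\<^sup>2"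
  proof -
    have "sinh x * (cosh x * (arsinh u)\<^sup>2) < sinh x * (cosh x * (u * arctan u))"
      using s c key by simp
    also have "\<dots> = (sinh x)\<^sup>2 * arctan u"
      using c by (simp add: u_def tanh_def power2_eq_square)
    finally show ?thesis
      using A u by (simp add: field_simps)
  qed
  finally have "log_seiffert (2 * x) < ln ((sinh x / arsinh u)\<^sup>2)"
    unfolding log_seiffert_def using sinh_div_arctan_pos[of "2 * x"] assms s A
    by (subst ln_less_cancel_iff) auto
  also have "\<dots> = 2 * log_neuman_sandor x"
    using s A by (simp add: log_neuman_sandor_def u_def ln_realpow)
  finally show ?thesis by simp
qed

section \<open>Monotonicity in the exponent\<close>

text \<open>
  Two separate estimates suffice. The factor \<open>t sin t + cos t\<close> is at least its value \<open>1\<close> at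
  \<open>0\<close>. Moreover \<open>t\<^sup>2 cos t \<le> (sin t)\<^sup>2\<close>: with \<open>h = t / 2\<close> the bound \<open>h \<le> tan h\<close> gives
  \<open>t (cos h)\<^sup>2 \<le> sin t\<close>, and \<open>cos t = 2 (cos h)\<^sup>2 - 1 \<le> (cos h)\<^sup>4\<close>.
\<close>

lemma square_mult_cos_le:
  fixes t :: real
  assumes "0 < t" "t < pi / 2"
  shows "t\<^sup>2 * cos t \<le> (sin t)\<^sup>2 * (t * sin t + cos t)"
proof -
  define h where "h = t / 2"
  have h: "0 < h" "h < pi / 2" "t = 2 * h" using assms by (auto simp: h_def)
  have pos: "sin h > 0" "cos h > 0" "sin t > 0" "cos t > 0"
    using h assms by (auto intro!: sin_gt_zero cos_gt_zero)
  have "h \<le> tan h"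
    using arctan_less_self[of "tan h"] h by (simp add: arctan_tan tan_gt_zero)
  then have "h * cos h \<le> sin h" using pos by (simp add: tan_def field_simps)
  then have "t * (cos h)\<^sup>2 \<le> sin t"
    using pos by (simp add: h(3) sin_double power2_eq_square)
  then have sin_t: "(t * (cos h)\<^sup>2)\<^sup>2 \<le> (sin t)\<^sup>2"
    using assms by (intro power_mono) auto
  have "0 \<le> (1 - (cos h)\<^sup>2)\<^sup>2" by simp
  also have "\<dots> = ((cos h)\<^sup>2)\<^sup>2 - cos t"
    using cos_double_cos[of h] by (simp add: \<open>t = 2 * h\<close> power2_eq_square algebra_simps)
  finally have "t\<^sup>2 * cos t \<le> t\<^sup>2 * ((cos h)\<^sup>2)\<^sup>2"
    by (intro mult_left_mono) auto
  also have "\<dots> \<le> (sin t)\<^sup>2"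
    using sin_t by (simp add: power_mult_distrib)
  also have "\<dots> \<le> (sin t)\<^sup>2 * (t * sin t + cos t)"
  proof -
    have "0 * sin 0 + cos 0 \<le> t * sin t + cos t"
    proof (rule DERIV_nonneg_imp_increasing_open[where f = "\<lambda>y. y * sin y + cos y"])
      fix y assume y: "0 < y" "y < t"
      have "((\<lambda>y. y * sin y + cos y) has_real_derivative y * cos y) (at y)"
        by (auto intro!: derivative_eq_intros)
      moreover have "y * cos y \<ge> 0" using y assms by (simp add: cos_gt_zero less_imp_le)
      ultimately show "\<exists>d. ((\<lambda>y. y * sin y + cos y) has_real_derivative d) (at y) \<and> d \<ge> 0"
        by blast
    qed (use assms in \<open>auto intro!: continuous_intros\<close>)
    then have "1 \<le> t * sin t + cos t" by simp
    then show ?thesis by (simp add: mult_le_cancel_left1)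
  qed
  finally show ?thesis .
qed

text \<open>
  The function considered here is the derivative of \<open>log_seiffert\<close>, expressed through
  \<open>t = arctan (sinh x)\<close>; its monotonicity therefore is the convexity of \<open>log_seiffert\<close> on the
  positive half-line. The sign of its own derivative is decided by the preceding inequality.
\<close>

lemma inverse_sin_diff_mono:
  fixes s t :: real
  assumes "0 < s" "s \<le> t" "t < pi / 2"
  shows "1 / sin s - cos s / s \<le> 1 / sin t - cos t / t"
proof (rule DERIV_nonneg_imp_nondecreasing[OF \<open>s \<le> t\<close>])
  fix y assume "s \<le> y" "y \<le> t"
  then have y: "0 < y" "y < pi / 2" using assms by auto
  then have sn: "sin y > 0" by (simp add: sin_gt_zero)
  have "((\<lambda>y. 1 / sin y - cos y / y) has_real_derivative
      - cos y / (sin y)\<^sup>2 - (- sin y * y - cos y) / y\<^sup>2) (at y)"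
    using y sn by (auto intro!: derivative_eq_intros simp: power2_eq_square)
  also have "- cos y / (sin y)\<^sup>2 - (- sin y * y - cos y) / y\<^sup>2
      = ((sin y)\<^sup>2 * (y * sin y + cos y) - y\<^sup>2 * cos y) / (y\<^sup>2 * (sin y)\<^sup>2)"
    using y sn by (simp add: field_simps)
  finally show "\<exists>d. ((\<lambda>y. 1 / sin y - cos y / y) has_real_derivative d) (at y) \<and> 0 \<le> d"
    using square_mult_cos_le[OF y] by (meson diff_ge_0_iff_ge divide_nonneg_nonneg mult_nonneg_nonneg zero_le_power2)
qed

lemma DERIV_log_seiffert:
  assumes "0 < x"
  shows "(log_seiffert has_real_derivative
    1 / sin (arctan (sinh x)) - cos (arctan (sinh x)) / arctan (sinh x)) (at x)"
proof -
  have s: "sinh x > 0" and c: "cosh x > 0" and A: "arctan (sinh x) > 0"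
    using assms by simp_all
  have r: "sqrt (1 + (sinh x)\<^sup>2) = cosh x"
    using c by (intro real_sqrt_unique) (simp_all add: cosh_square_eq)
  have sinh': "(sinh has_real_derivative cosh x) (at x)"
    by (auto intro!: derivative_eq_intros)
  have A': "((\<lambda>x. arctan (sinh x)) has_real_derivative cosh x / (cosh x)\<^sup>2) (at x)"
    by (auto intro!: derivative_eq_intros simp: cosh_square_eq divide_inverse add.commute)
  have "((\<lambda>x. sinh x / arctan (sinh x)) has_real_derivative
      (cosh x * arctan (sinh x) - sinh x * (cosh x / (cosh x)\<^sup>2)) / (arctan (sinh x))\<^sup>2) (at x)"
    using DERIV_divide[OF sinh' A'] A by (simp add: power2_eq_square)
  then have "(log_seiffert has_real_derivative
      1 / (sinh x / arctan (sinh x)) *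
      ((cosh x * arctan (sinh x) - sinh x * (cosh x / (cosh x)\<^sup>2)) / (arctan (sinh x))\<^sup>2)) (at x)"
    unfolding log_seiffert_def
    using sinh_div_arctan_pos[of x] assms by (intro DERIV_chain'[OF _ DERIV_ln_divide]) auto
  also have "1 / (sinh x / arctan (sinh x)) *
      ((cosh x * arctan (sinh x) - sinh x * (cosh x / (cosh x)\<^sup>2)) / (arctan (sinh x))\<^sup>2)
      = 1 / sin (arctan (sinh x)) - cos (arctan (sinh x)) / arctan (sinh x)"
    unfolding sin_arctan cos_arctan r
    using s c A by (simp add: field_simps power2_eq_square)
  finally show ?thesis .
qed

text \<open>
  A convex function that vanishes at \<open>0\<close> lies below its chords from \<open>0\<close>. The difference
  of the two sides is differentiated instead of appealing to convexity on a closed half-line,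
  so that only the limit at \<open>0\<close> is needed there.
\<close>

lemma log_seiffert_scale_le:
  assumes "0 < l" "l \<le> 1" "0 < x"
  shows "log_seiffert (l * x) \<le> l * log_seiffert x"
proof -
  define f where "f y = l * log_seiffert y - log_seiffert (l * y)" for y
  define m where "m y = 1 / sin (arctan (sinh y)) - cos (arctan (sinh y)) / arctan (sinh y)" for y :: real
  have der: "(f has_real_derivative l * (m y - m (l * y))) (at y)" if "0 < y" for y
  proof -
    have 1: "(log_seiffert has_real_derivative m y) (at y)" if "0 < y" for y
      using DERIV_log_seiffert[OF that] by (simp add: m_def)
    have "((\<lambda>y. log_seiffert (l * y)) has_real_derivative m (l * y) * l) (at y)"
      using DERIV_chain'[OF DERIV_cmult_Id[of l] 1, of y] that assms by simp
    with DERIV_cmult[OF 1[OF that], of l] show ?thesis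
      unfolding f_def by (auto dest: DERIV_diff simp: algebra_simps)
  qed
  have "f 0 \<le> f x"
  proof (rule DERIV_nonneg_imp_increasing_open[where f = f])
    fix y assume y: "0 < y" "y < x"
    have "0 < arctan (sinh (l * y))" "arctan (sinh (l * y)) \<le> arctan (sinh y)"
      "arctan (sinh y) < pi / 2"
      using y assms arctan_ubound[of "sinh y"] by (simp_all add: arctan_le_iff)
    then have "m (l * y) \<le> m y"
      unfolding m_def by (rule inverse_sin_diff_mono)
    then have "l * (m y - m (l * y)) \<ge> 0" using assms by simp
    with der[OF y(1)] show "\<exists>d. (f has_real_derivative d) (at y) \<and> d \<ge> 0" by blast
  next
    have lim: "(log_seiffert \<longlongrightarrow> 0) (at_right 0)"
      unfolding log_seiffert_def by real_asymp
    have "((\<lambda>y. log_seiffert (l * y)) \<longlongrightarrow> 0) (at_right 0)"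
      by (rule filterlim_compose[OF lim]) (use assms in real_asymp)
    then have "(f \<longlongrightarrow> l * 0 - 0) (at_right 0)"
      unfolding f_def by (intro tendsto_intros lim)
    then show "continuous_on {0..x} f"
      using der DERIV_isCont assms
      by (intro continuous_on_Icc_at_right) (auto simp: f_def[of 0] log_seiffert_def[of 0])
  qed (use assms in auto)
  then show ?thesis by (simp add: f_def log_seiffert_def[of 0])
qed

lemma log_seiffert_pos:
  assumes "x \<noteq> 0"
  shows "0 < log_seiffert x"
proof -
  have "0 < log_seiffert x" if "0 < x" for x
    using arctan_less_self[of "sinh x"] that by (simp add: log_seiffert_def)
  from this[of x] this[of "-x"] assms show ?thesis
    by (cases "x > 0") (auto simp: log_seiffert_minus)
qed

section \<open>Exponents above two\<close>

lemma ex_log_neuman_sandor_less: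
  assumes "2 < p"
  shows "\<exists>x>0. log_neuman_sandor x < log_seiffert (p * x) / p"
proof -
  have P: "((\<lambda>x. log_seiffert x / x\<^sup>2) \<longlongrightarrow> 1 / 3) (at_right 0)"
    unfolding log_seiffert_def by real_asymp
  have N: "((\<lambda>x. log_neuman_sandor x / x\<^sup>2) \<longlongrightarrow> 2 / 3) (at_right 0)"
    unfolding log_neuman_sandor_def by real_asymp
  have "((\<lambda>x. log_seiffert (p * x) / (p * x)\<^sup>2) \<longlongrightarrow> 1 / 3) (at_right 0)"
    by (rule filterlim_compose[OF P]) (use assms in real_asymp)
  then have "((\<lambda>x. p * (log_seiffert (p * x) / (p * x)\<^sup>2) - log_neuman_sandor x / x\<^sup>2)
      \<longlongrightarrow> p * (1 / 3) - 2 / 3) (at_right 0)"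
    by (intro tendsto_diff tendsto_mult tendsto_const N)
  moreover have "p * (1 / 3) - 2 / 3 > 0" using assms by simp
  ultimately have "eventually (\<lambda>x. p * (log_seiffert (p * x) / (p * x)\<^sup>2)
      - log_neuman_sandor x / x\<^sup>2 > 0) (at_right 0)"
    by (rule order_tendstoD)
  then have "eventually (\<lambda>x. x > 0 \<and> p * (log_seiffert (p * x) / (p * x)\<^sup>2)
      - log_neuman_sandor x / x\<^sup>2 > 0) (at_right 0)"
    using eventually_at_right_less[of 0] by eventually_elim auto
  then obtain x where x: "x > 0"
    "p * (log_seiffert (p * x) / (p * x)\<^sup>2) - log_neuman_sandor x / x\<^sup>2 > 0"
    using eventually_happens' trivial_limit_at_right_real by blast
  have "p * (log_seiffert (p * x) / (p * x)\<^sup>2) - log_neuman_sandor x / x\<^sup>2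
      = (log_seiffert (p * x) / p - log_neuman_sandor x) / x\<^sup>2"
    using x(1) assms by (simp add: field_simps power2_eq_square)
  with x(2) have "(log_seiffert (p * x) / p - log_neuman_sandor x) / x\<^sup>2 > 0"
    by (simp only:)
  with x(1) have "log_neuman_sandor x < log_seiffert (p * x) / p"
    by (simp add: zero_less_divide_iff)
  with x(1) show ?thesis by blast
qed

theorem theorem4:
  fixes p :: real
  shows "(\<forall>a b :: real. a > 0 \<and> b > 0 \<and> a \<noteq> b \<longrightarrow>
            seiffert_mean_pow p a b < neuman_sandor_mean a b)
         \<longleftrightarrow> p \<le> 2"
  unfolding seiffert_mean_pow_less_iff
proof
  assume "\<forall>x>0. log_seiffert (p * x) / p < log_neuman_sandor x"
  then show "p \<le> 2"
    using ex_log_neuman_sandor_less[of p] by (meson less_asym not_le)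
next
  assume p: "p \<le> 2"
  show "\<forall>x>0. log_seiffert (p * x) / p < log_neuman_sandor x"
  proof (intro allI impI)
    fix x :: real
    assume x: "x > 0"
    have "log_seiffert (p * x) / p \<le> log_seiffert (2 * x) / 2"
    proof (cases "p > 0")
      case True
      then show ?thesis
        using log_seiffert_scale_le[of "p / 2" "2 * x"] p x by (simp add: field_simps)
    next
      case False
      then have "log_seiffert (p * x) / p \<le> 0"
        using log_seiffert_pos[of "p * x"] x by (cases "p = 0") (auto simp: divide_le_0_iff)
      also have "0 \<le> log_seiffert (2 * x) / 2"
        using log_seiffert_pos[of "2 * x"] x by simp
      finally show ?thesis .
    qed
    also have "\<dots> < log_neuman_sandor x"
      using x by (rule log_seiffert_two_less)
    finally show "log_seiffert (p * x) / p < log_neuman_sandor x" .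
  qed
qed

end
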